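(* For all $p,q\in\mathbb{R}_n[t]$, with symmetric multiaffine lifts $\widetilde p,\widetilde q\in\mathcal{A}_n$, $$p\boxplus_n q=\operatorname{Sym}(\widetilde p\boxplus\widetilde q),\qquad p\boxtimes_n q=\operatorname{Sym}(\widetilde p\circ\widetilde q).$$
   Context: $\mathbb{R}_n[t]$ is the space of real polynomials of degree at most $n$. For $p(t)=\sum_{k=0}^n p_kt^k$ set $\beta_n(p)_k:=p_k/\binom nk$, $0\le k\le n$. Finite free convolutions on $\mathbb{R}_n[t]$: $$p\boxtimes_n q:=\sum_{k=0}^n\binom nk\beta_n(p)_k\,\beta_n(q)_k\,t^k,\qquad p\boxplus_n q:=\sum_{k=0}^n\binom nk\Bigl(\sum_{a+b=k}\binom ka\beta_n(p)_a\,\beta_n(q)_b\Bigr)t^k,$$ the inner sum being over integers $a,b\ge0$. $\mathcal{A}_n:=\mathbb{R}[t_1,\dots,t_n]/(t_1^2,\dots,t_n^2)$ has basis $t^S:=\prod_{i\in S}t_i$, $S\subseteq[n]=\{1,\dots,n\}$; write $f=\sum_S f_St^S$, and identify elements of $\mathcal{A}_n$ with set functions $S\mapsto f_S$. The linear map $\operatorname{Sym}:\mathcal{A}_n\to\mathbb{R}_n[t]$ is given by $t^S\mapsto t^{|S|}$. The additive convolution on $\mathcal{A}_n$ is $(f\boxplus g)_S:=\sum_{A\subseteq S}f_A\,g_{S\setminus A}$ and the Hadamard product is $(f\circ g)_S:=f_S\,g_S$. The multiaffine lift $\widetilde p\in\mathcal{A}_n$ of $p\in\mathbb{R}_n[t]$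 is the unique symmetric multiaffine polynomial with $\operatorname{Sym}(\widetilde p)=p$; that is, $\widetilde p_S=\beta_n(p)_{|S|}$ for all $S\subseteq[n]$. *)

theory Defs
  imports
    "HOL-Computational_Algebra.Polynomial"
    "HOL-Combinatorics.Permutations"
begin

definition polys_upto :: "nat \<Rightarrow> real poly set" where
  "polys_upto n = {p. degree p \<le> n}"

definition beta :: "nat \<Rightarrow> real poly \<Rightarrow> nat \<Rightarrow> real" where
  "beta n p k = coeff p k / real (n choose k)"

definition finite_free_mult :: "nat \<Rightarrow> real poly \<Rightarrow> real poly \<Rightarrow> real poly" where
  "finite_free_mult n p q = (\<Sum>k\<le>n. monom (real (n choose k) * beta n p k * beta n q k) k)"

definition finite_free_add :: "nat \<Rightarrow> real poly \<Rightarrow> real poly \<Rightarrow> real poly" where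
  "finite_free_add n p q =
     (\<Sum>k\<le>n. monom (real (n choose k) *
        (\<Sum>(a, b)\<in>{(a, b). a + b = k}. real (k choose a) * beta n p a * beta n q b)) k)"

text \<open>
  An element \<open>f = (\<Sum>S. f\<^sub>S t\<^sup>S)\<close> of \<open>\<real>[t\<^sub>1,\<dots>,t\<^sub>n]/(t\<^sub>1\<^sup>2,\<dots>,t\<^sub>n\<^sup>2)\<close> is represented by its
  coordinates in the basis \<open>t\<^sup>S\<close>, \<open>S \<subseteq> {1..n}\<close>, i.e. by a set function that is \<open>0\<close> on
  every index set not contained in \<open>{1..n}\<close>.
\<close>

definition multiaffine :: "nat \<Rightarrow> (nat set \<Rightarrow> real) set" where
  "multiaffine n = {f. \<forall>S. \<not> S \<subseteq> {1..n} \<longrightarrow> f S = 0}"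

definition Sym :: "nat \<Rightarrow> (nat set \<Rightarrow> real) \<Rightarrow> real poly" where
  "Sym n f = (\<Sum>S\<in>Pow {1..n}. smult (f S) (monom 1 (card S)))"

definition additive_conv :: "(nat set \<Rightarrow> real) \<Rightarrow> (nat set \<Rightarrow> real) \<Rightarrow> nat set \<Rightarrow> real" where
  "additive_conv f g S = (\<Sum>A\<in>Pow S. f A * g (S - A))"

definition hadamard :: "(nat set \<Rightarrow> real) \<Rightarrow> (nat set \<Rightarrow> real) \<Rightarrow> nat set \<Rightarrow> real" where
  "hadamard f g S = f S * g S"

text \<open>
  Invariance under permuting the variables: \<open>t\<^sub>i \<mapsto> t\<^bsub>\<pi> i\<^esub>\<close> sends \<open>t\<^sup>S\<close> to the basis
  element indexed by \<open>\<pi> ` S\<close>.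
\<close>

definition symmetric_multiaffine :: "nat \<Rightarrow> (nat set \<Rightarrow> real) \<Rightarrow> bool" where
  "symmetric_multiaffine n f \<longleftrightarrow>
     f \<in> multiaffine n \<and> (\<forall>\<pi>. \<pi> permutes {1..n} \<longrightarrow> (\<forall>S\<subseteq>{1..n}. f (\<pi> ` S) = f S))"

text \<open>
  Existence and uniqueness for \<open>p \<in> polys_upto n\<close>, and the explicit coefficients, are
  \<open>ex1_multiaffine_lift\<close> and \<open>multiaffine_lift_eq\<close> below.
\<close>

definition multiaffine_lift :: "nat \<Rightarrow> real poly \<Rightarrow> nat set \<Rightarrow> real" where
  "multiaffine_lift n p = (THE f. symmetric_multiaffine n f \<and> Sym n f = p)"


lemma additive_conv_closed:
  assumes "f \<in> multiaffine n" "g \<in> multiaffine n"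
  shows "additive_conv f g \<in> multiaffine n"
  unfolding multiaffine_def additive_conv_def mem_Collect_eq
proof (intro allI impI sum.neutral ballI)
  fix S A
  assume "\<not> S \<subseteq> {1..n}"
  then have "\<not> A \<subseteq> {1..n} \<or> \<not> S - A \<subseteq> {1..n}" by blast
  then have "f A = 0 \<or> g (S - A) = 0" using assms unfolding multiaffine_def by blast
  then show "f A * g (S - A) = 0" by (simp only: mult_eq_0_iff)
qed

lemma hadamard_closed:
  assumes "f \<in> multiaffine n"
  shows "hadamard f g \<in> multiaffine n"
  using assms by (simp add: multiaffine_def hadamard_def)

lemma ex_permutes_image:
  assumes "finite U" "S \<subseteq> U" "T \<subseteq> U" "card S = card T"
  shows "\<exists>\<pi>. \<pi> permutes U \<and> \<pi> ` S = T"
proof -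
  have fin: "finite S" "finite T" using assms finite_subset by auto
  obtain f where f: "bij_betw f S T"
    using finite_same_card_bij[OF fin assms(4)] by blast
  have "card (U - S) = card (U - T)"
    using assms fin by (simp add: card_Diff_subset)
  then obtain g where g: "bij_betw g (U - S) (U - T)"
    using finite_same_card_bij assms(1) by blast
  define h where "h x = (if x \<in> S then f x else if x \<in> U then g x else x)" for x
  have hS: "bij_betw h S T"
    using f by (rule iffD1[OF bij_betw_cong, rotated]) (simp add: h_def)
  have hU: "bij_betw h (U - S) (U - T)"
    using g by (rule iffD1[OF bij_betw_cong, rotated]) (simp add: h_def)
  have "bij_betw h (S \<union> (U - S)) (T \<union> (U - T))"
    by (rule bij_betw_combine[OF hS hU]) auto
  moreover have "S \<union> (U - S) = U" "T \<union> (U - T) = U" using assms by auto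
  ultimately have "bij_betw h U U" by simp
  then have "h permutes U"
    by (rule bij_imp_permutes) (use assms in \<open>auto simp: h_def\<close>)
  moreover have "h ` S = T" using hS by (simp add: bij_betw_def)
  ultimately show ?thesis by blast
qed

lemma symmetric_multiaffine_card_cong:
  assumes "symmetric_multiaffine n f" "S \<subseteq> {1..n}" "T \<subseteq> {1..n}" "card S = card T"
  shows "f S = f T"
proof -
  obtain \<pi> where "\<pi> permutes {1..n}" and im: "\<pi> ` S = T"
    using ex_permutes_image[OF _ assms(2-4)] by blast
  then have "f (\<pi> ` S) = f S" using assms(1,2) unfolding symmetric_multiaffine_def by blast
  then show ?thesis unfolding im by (rule sym)
qed

lemma coeff_Sym: "coeff (Sym n f) k = (\<Sum>S | S \<subseteq> {1..n} \<and> card S = k. f S)"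
proof -
  have "coeff (Sym n f) k = (\<Sum>S\<in>Pow {1..n}. if card S = k then f S else 0)"
    unfolding Sym_def coeff_sum by (rule sum.cong) auto
  also have "\<dots> = (\<Sum>S | S \<in> Pow {1..n} \<and> card S = k. f S)"
    by (rule sum.inter_filter[symmetric]) simp
  finally show ?thesis by simp
qed

lemma symmetric_multiaffine_eq_beta:
  assumes "symmetric_multiaffine n f" "S \<subseteq> {1..n}"
  shows "f S = beta n (Sym n f) (card S)"
proof -
  have le: "card S \<le> n" using card_mono[OF _ assms(2)] by simp
  have "coeff (Sym n f) (card S) = (\<Sum>T | T \<subseteq> {1..n} \<and> card T = card S. f S)"
    unfolding coeff_Sym
  proof (rule sum.cong)
    fix T assume "T \<in> {T. T \<subseteq> {1..n} \<and> card T = card S}"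
    then show "f T = f S"
      by (intro symmetric_multiaffine_card_cong[OF assms(1) _ assms(2)]) blast+
  qed (rule refl)
  also have "\<dots> = real (n choose card S) * f S"
    using n_subsets[of "{1..n}" "card S"] by simp
  finally show ?thesis using le by (simp add: beta_def)
qed

lemma symmetric_multiaffine_beta:
  assumes "p \<in> polys_upto n"
  defines "f \<equiv> \<lambda>S. if S \<subseteq> {1..n} then beta n p (card S) else 0"
  shows "symmetric_multiaffine n f" "Sym n f = p"
proof -
  have "f (\<pi> ` S) = f S" if "\<pi> permutes {1..n}" "S \<subseteq> {1..n}" for \<pi> S
  proof -
    have "\<pi> ` S \<subseteq> {1..n}" using that permutes_image by blast
    moreover have "card (\<pi> ` S) = card S"
      by (rule card_image) (use permutes_inj_on[OF that(1)] in blast)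
    ultimately show ?thesis using that by (simp add: f_def)
  qed
  then show "symmetric_multiaffine n f"
    by (simp add: symmetric_multiaffine_def multiaffine_def f_def)
  show "Sym n f = p"
  proof (rule poly_eqI)
    fix k
    have "coeff (Sym n f) k = (\<Sum>T | T \<subseteq> {1..n} \<and> card T = k. beta n p k)"
      unfolding coeff_Sym by (rule sum.cong) (auto simp: f_def)
    also have "\<dots> = real (n choose k) * beta n p k"
      using n_subsets[of "{1..n}" k] by simp
    also have "\<dots> = coeff p k"
      using assms(1) by (cases "k \<le> n") (auto simp: beta_def polys_upto_def coeff_eq_0)
    finally show "coeff (Sym n f) k = coeff p k" .
  qed
qed

lemma ex1_multiaffine_lift:
  assumes "p \<in> polys_upto n"
  shows "\<exists>!f. symmetric_multiaffine n f \<and> Sym n f = p"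
proof (rule ex_ex1I)
  show "\<exists>f. symmetric_multiaffine n f \<and> Sym n f = p"
    using symmetric_multiaffine_beta[OF assms] by blast
next
  fix f g
  assume f: "symmetric_multiaffine n f \<and> Sym n f = p"
    and g: "symmetric_multiaffine n g \<and> Sym n g = p"
  show "f = g"
  proof
    fix S
    show "f S = g S"
    proof (cases "S \<subseteq> {1..n}")
      case True
      then show ?thesis
        using f g symmetric_multiaffine_eq_beta[of n f S] symmetric_multiaffine_eq_beta[of n g S]
        by simp
    next
      case False
      then show ?thesis
        using f g by (simp add: symmetric_multiaffine_def multiaffine_def)
    qed
  qed
qed

lemma multiaffine_lift_eq:
  assumes "p \<in> polys_upto n" "S \<subseteq> {1..n}"
  shows "multiaffine_lift n p S = beta n p (card S)"
proof -
  have "symmetric_multiaffine n (multiaffine_lift n p) \<and> Sym n (multiaffine_lift n p) = p"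
    unfolding multiaffine_lift_def by (rule theI'[OF ex1_multiaffine_lift[OF assms(1)]])
  then have sym: "symmetric_multiaffine n (multiaffine_lift n p)"
    and eq: "Sym n (multiaffine_lift n p) = p" by (rule conjunct1, rule conjunct2)
  show ?thesis using symmetric_multiaffine_eq_beta[OF sym assms(2)] unfolding eq .
qed

end

theory Submission
  imports Defs
begin

text \<open>On subsets of \<open>{1..n}\<close> a symmetric lift depends only on cardinality, and
  both operations preserve this: the Hadamard product takes values
  \<open>beta n p k * beta n q k\<close> on sets of size \<open>k\<close>, and the additive
  convolution groups the subsets \<open>A\<close> of \<open>S\<close> by size,
  \<open>card S choose a\<close> of them for each \<open>a\<close>. Applying \<open>Sym\<close>
  collects the \<open>n choose k\<close> equal coefficients in degree \<open>k\<close>, which is the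
  outer binomial in both definitions. So one count of subsets by size (\<open>sum_Pow_card\<close>)
  serves twice: inside a set \<open>S\<close> for the inner sum, and inside \<open>{1..n}\<close>
  for \<open>Sym\<close>.\<close>

lemma sum_Pow_card:
  fixes h :: "nat \<Rightarrow> 'b::comm_semiring_1"
  assumes "finite S"
  shows "(\<Sum>A\<in>Pow S. h (card A)) = (\<Sum>k\<le>card S. of_nat (card S choose k) * h k)"
proof -
  have "(\<Sum>A\<in>Pow S. h (card A)) = (\<Sum>k\<le>card S. \<Sum>A | A \<in> Pow S \<and> card A = k. h (card A))"
    by (rule sum.group[symmetric]) (use assms in \<open>auto intro: card_mono\<close>)
  also have "\<dots> = (\<Sum>k\<le>card S. of_nat (card S choose k) * h k)"
    using n_subsets[OF assms] by simp
  finally show ?thesis .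
qed

text \<open>Both identities reduce to this: only the profile \<open>h\<close> of the set function by
  cardinality remains to be found.\<close>

lemma Sym_card:
  assumes "\<And>S. S \<subseteq> {1..n} \<Longrightarrow> f S = h (card S)"
  shows "Sym n f = (\<Sum>k\<le>n. monom (real (n choose k) * h k) k)"
proof -
  have "Sym n f = (\<Sum>S\<in>Pow {1..n}. monom (h (card S)) (card S))"
    unfolding Sym_def by (rule sum.cong) (simp_all add: assms smult_monom)
  \<comment> \<open>Here the summands are polynomials, whereas the inner convolution sum is real;
    hence the semiring-valued \<open>h\<close> in \<open>sum_Pow_card\<close>.\<close>
  also have "\<dots> = (\<Sum>k\<le>n. of_nat (n choose k) * monom (h k) k)"
    using sum_Pow_card[of "{1..n}" "\<lambda>k. monom (h k) k"] by simp
  finally show ?thesis by (simp add: of_nat_poly smult_monom)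
qed

text \<open>Splitting \<open>S\<close> into \<open>A\<close> and \<open>S - A\<close> splits
  \<open>card S\<close> as \<open>a + b\<close>, and each \<open>a\<close> arises from
  \<open>card S choose a\<close> sets \<open>A\<close>.\<close>

lemma additive_conv_multiaffine_lift:
  assumes "p \<in> polys_upto n" "q \<in> polys_upto n" "S \<subseteq> {1..n}"
  shows "additive_conv (multiaffine_lift n p) (multiaffine_lift n q) S =
    (\<Sum>(a, b)\<in>{(a, b). a + b = card S}. real (card S choose a) * beta n p a * beta n q b)"
proof -
  have fin: "finite S" using assms(3) finite_subset by blast
  have "additive_conv (multiaffine_lift n p) (multiaffine_lift n q) S =
      (\<Sum>A\<in>Pow S. beta n p (card A) * beta n q (card S - card A))"
    unfolding additive_conv_def
  proof (rule sum.cong)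
    fix A assume "A \<in> Pow S"
    then have "A \<subseteq> {1..n}" "S - A \<subseteq> {1..n}" "card (S - A) = card S - card A"
      using assms(3) fin by (auto intro!: card_Diff_subset intro: finite_subset)
    then show "multiaffine_lift n p A * multiaffine_lift n q (S - A) =
        beta n p (card A) * beta n q (card S - card A)"
      using assms by (simp add: multiaffine_lift_eq)
  qed simp
  also have "\<dots> = (\<Sum>a\<le>card S. real (card S choose a) * beta n p a * beta n q (card S - a))"
    using sum_Pow_card[OF fin, of "\<lambda>a. beta n p a * beta n q (card S - a)"]
    by (simp add: mult.assoc)
  also have "\<dots> = (\<Sum>(a, b)\<in>{(a, b). a + b = card S}.
      real (card S choose a) * beta n p a * beta n q b)"
    \<comment> \<open>The pair is determined by its first entry; truncated subtraction is exact
      because \<open>a \<le> card S\<close>.\<close>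
    by (rule sum.reindex_bij_witness[of _ fst "\<lambda>a. (a, card S - a)"]) auto
  finally show ?thesis .
qed

theorem proposition3p5:
  fixes n :: nat and p q :: "real poly"
  assumes "p \<in> polys_upto n" and "q \<in> polys_upto n"
  shows "finite_free_add n p q =
           Sym n (additive_conv (multiaffine_lift n p) (multiaffine_lift n q)) \<and>
         finite_free_mult n p q =
           Sym n (hadamard (multiaffine_lift n p) (multiaffine_lift n q))"
proof
  show "finite_free_add n p q =
      Sym n (additive_conv (multiaffine_lift n p) (multiaffine_lift n q))"
    unfolding finite_free_add_def
    by (rule Sym_card[symmetric]) (rule additive_conv_multiaffine_lift[OF assms])
  have "hadamard (multiaffine_lift n p) (multiaffine_lift n q) S =
      beta n p (card S) * beta n q (card S)" if "S \<subseteq> {1..n}" for S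
    using assms that by (simp add: hadamard_def multiaffine_lift_eq)
  from Sym_card[where h = "\<lambda>k. beta n p k * beta n q k", OF this] show "finite_free_mult n p q =
      Sym n (hadamard (multiaffine_lift n p) (multiaffine_lift n q))"
    by (simp add: finite_free_mult_def mult.assoc)
qed

end
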